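(* Let $\mathcal{H}$ be a complex Hilbert space, let $A\in\mathcal{B}(\mathcal{H})$ be a positive operator, and let $T\in\mathcal{B}_A(\mathcal{H})$. Then $$w_A^2(T)\le\min\{\beta_1,\beta_2\},$$ where $$\beta_1=\min_{0\le\alpha\le1}\left\{\frac{\alpha}{2}\,w_A(T^2)+\left\|\frac{\alpha}{4}\,TT^{\sharp_A}+\left(1-\frac{3\alpha}{4}\right)T^{\sharp_A}T\right\|_A\right\}$$ and $$\beta_2=\min_{0\le\alpha\le1}\left\{\frac{\alpha}{2}\,w_A(T^2)+\left\|\left(1-\frac{3\alpha}{4}\right)TT^{\sharp_A}+\frac{\alpha}{4}\,T^{\sharp_A}T\right\|_A\right\}.$$
   Context: $\mathcal{H}$ is a complex Hilbert space with inner product $\langle\cdot,\cdot\rangle$ (linear in the first variable), $\mathcal{B}(\mathcal{H})$ is the algebra of bounded linear operators on $\mathcal{H}$, and $A\in\mathcal{B}(\mathcal{H})$ is a positive operator (i.e. $\langle Ax,x\rangle\ge 0$ for all $x$; not necessarily injective or with closed range). Put $\langle x,y\rangle_A=\langle Ax,y\rangle$ and $\|x\|_A=\sqrt{\langle x,x\rangle_A}$. An operator $R\in\mathcal{B}(\mathcal{H})$ is an $A$-adjoint of $T\in\mathcal{B}(\mathcal{H})$ if $\langle Tx,y\rangle_A=\langle x,Ry\rangle_A$ for all $x,y\in\mathcal{H}$. $\mathcal{B}_A(\mathcal{H})$ is the set of all $T\in\mathcal{B}(\mathcal{H})$ admitting an $A$-adjoint; equivalently, $R(T^*A)\subseteq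 R(A)$, where $R(\cdot)$ denotes range. For $T\in\mathcal{B}_A(\mathcal{H})$, $T^{\sharp_A}$ denotes the unique $A$-adjoint with range contained in $\overline{R(A)}$, i.e. the unique solution $X$ of $AX=T^*A$ with $R(X)\subseteq\overline{R(A)}$. For $T\in\mathcal{B}_A(\mathcal{H})$, the $A$-operator seminorm is $\|T\|_A=\sup\{\|Tx\|_A: x\in\mathcal{H},\ \|x\|_A=1\}$ and the $A$-numerical radius is $w_A(T)=\sup\{|\langle Tx,x\rangle_A|: x\in\mathcal{H},\ \|x\|_A=1\}$. Write $w_A^2(T)=(w_A(T))^2$. *)

theory Defs
  imports "HOL-Analysis.Analysis" "HOL-Library.Nonpos_Ints"
begin

text \<open>Complex Hilbert spaces. The inner product is linear in its first argument. The norm of the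
  underlying Banach space is the one induced by the inner product.\<close>

class complex_hilbert_space = banach +
  fixes scaleC :: "complex \<Rightarrow> 'a \<Rightarrow> 'a" (infixr \<open>*\<^sub>C\<close> 75)
    and cinner :: "'a \<Rightarrow> 'a \<Rightarrow> complex"
  assumes scaleC_add_right: "c *\<^sub>C (x + y) = c *\<^sub>C x + c *\<^sub>C y"
    and scaleC_add_left: "(c + d) *\<^sub>C x = c *\<^sub>C x + d *\<^sub>C x"
    and scaleC_scaleC: "c *\<^sub>C (d *\<^sub>C x) = (c * d) *\<^sub>C x"
    and scaleC_one: "1 *\<^sub>C x = x"
    and scaleR_scaleC: "r *\<^sub>R x = complex_of_real r *\<^sub>C x"
    and cinner_commute: "cinner x y = cnj (cinner y x)"
    and cinner_add_left: "cinner (x + y) z = cinner x z + cinner y z"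
    and cinner_scaleC_left: "cinner (c *\<^sub>C x) y = c * cinner x y"
    and cinner_nonneg: "cinner x x \<in> \<real>\<^sub>\<ge>\<^sub>0"
    and cinner_eq_zero_iff: "cinner x x = 0 \<longleftrightarrow> x = 0"
    and norm_eq_sqrt_cinner: "norm x = sqrt (Re (cinner x x))"

instantiation complex :: complex_hilbert_space
begin

definition scaleC_complex :: "complex \<Rightarrow> complex \<Rightarrow> complex"
  where "scaleC_complex c x = c * x"

definition cinner_complex :: "complex \<Rightarrow> complex \<Rightarrow> complex"
  where "cinner_complex x y = x * cnj y"

instance
  by standard
    (auto simp: scaleC_complex_def cinner_complex_def algebra_simps scaleR_conv_of_real
      cmod_def power2_eq_square complex_nonneg_Reals_iff)

end

definition bounded_operators :: "('a::complex_hilbert_space \<Rightarrow> 'a) set"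
  where "bounded_operators =
    {T. Vector_Spaces.linear scaleC scaleC T \<and> (\<exists>K. \<forall>x. norm (T x) \<le> K * norm x)}"

definition positive_operator :: "('a::complex_hilbert_space \<Rightarrow> 'a) \<Rightarrow> bool"
  where "positive_operator A \<longleftrightarrow> A \<in> bounded_operators \<and> (\<forall>x. cinner (A x) x \<in> \<real>\<^sub>\<ge>\<^sub>0)"

definition A_inner :: "('a::complex_hilbert_space \<Rightarrow> 'a) \<Rightarrow> 'a \<Rightarrow> 'a \<Rightarrow> complex"
  where "A_inner A x y = cinner (A x) y"

definition A_norm :: "('a::complex_hilbert_space \<Rightarrow> 'a) \<Rightarrow> 'a \<Rightarrow> real"
  where "A_norm A x = sqrt (Re (A_inner A x x))"

definition is_A_adjoint ::
    "('a::complex_hilbert_space \<Rightarrow> 'a) \<Rightarrow> ('a \<Rightarrow> 'a) \<Rightarrow> ('a \<Rightarrow> 'a) \<Rightarrow> bool"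
  where "is_A_adjoint A T R \<longleftrightarrow>
    R \<in> bounded_operators \<and> (\<forall>x y. A_inner A (T x) y = A_inner A x (R y))"

definition A_adjointable :: "('a::complex_hilbert_space \<Rightarrow> 'a) \<Rightarrow> ('a \<Rightarrow> 'a) set"
  where "A_adjointable A = {T \<in> bounded_operators. \<exists>R. is_A_adjoint A T R}"

text \<open>For a positive \<open>A\<close> and \<open>T \<in> A_adjointable A\<close> the operator described here exists and is unique:
  compose any \<open>A\<close>-adjoint with the orthogonal projection onto the closure of the range of \<open>A\<close>, which
  is the orthogonal complement of the kernel of \<open>A\<close>.\<close>

definition sharp :: "('a::complex_hilbert_space \<Rightarrow> 'a) \<Rightarrow> ('a \<Rightarrow> 'a) \<Rightarrow> 'a \<Rightarrow> 'a"
  where "sharp A T = (THE R. is_A_adjoint A T R \<and> range R \<subseteq> closure (range A))"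

text \<open>The two suprema are taken in \<open>[0, \<infinity>)\<close>. Inserting \<open>0\<close> does not change the supremum of a
  nonempty set of nonnegative reals; it only settles the degenerate case \<open>A = 0\<close>, where no vector
  has \<open>A\<close>-norm \<open>1\<close> and the supremum of the empty set is \<open>0\<close>. Both sets are bounded above for
  \<open>T \<in> A_adjointable A\<close>.\<close>

definition A_op_seminorm :: "('a::complex_hilbert_space \<Rightarrow> 'a) \<Rightarrow> ('a \<Rightarrow> 'a) \<Rightarrow> real"
  where "A_op_seminorm A T = Sup (insert 0 {A_norm A (T x) | x. A_norm A x = 1})"

definition A_numerical_radius :: "('a::complex_hilbert_space \<Rightarrow> 'a) \<Rightarrow> ('a \<Rightarrow> 'a) \<Rightarrow> real"
  where "A_numerical_radius A T = Sup (insert 0 {cmod (A_inner A (T x) x) | x. A_norm A x = 1})"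

text \<open>\<open>LEAST\<close> denotes the least element of the set of values, so the minimum is meant to be attained
  (unlike an infimum).\<close>

definition beta1 :: "('a::complex_hilbert_space \<Rightarrow> 'a) \<Rightarrow> ('a \<Rightarrow> 'a) \<Rightarrow> real"
  where "beta1 A T = (LEAST b. \<exists>\<alpha>\<in>{0..1}. b =
    \<alpha> / 2 * A_numerical_radius A (T \<circ> T) +
    A_op_seminorm A (\<lambda>x. (\<alpha> / 4) *\<^sub>R T (sharp A T x) + (1 - 3 * \<alpha> / 4) *\<^sub>R sharp A T (T x)))"

definition beta2 :: "('a::complex_hilbert_space \<Rightarrow> 'a) \<Rightarrow> ('a \<Rightarrow> 'a) \<Rightarrow> real"
  where "beta2 A T = (LEAST b. \<exists>\<alpha>\<in>{0..1}. b =
    \<alpha> / 2 * A_numerical_radius A (T \<circ> T) +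
    A_op_seminorm A (\<lambda>x. (1 - 3 * \<alpha> / 4) *\<^sub>R T (sharp A T x) + (\<alpha> / 4) *\<^sub>R sharp A T (T x)))"

end

theory Submission
  imports Defs
begin

text \<open>Let \<open>R\<close> be the distinguished \<open>A\<close>-adjoint of \<open>T\<close> and \<open>\<parallel>x\<parallel>\<^sub>A = 1\<close>. Buzano's inequality for the vectors
  \<open>Tx\<close>, \<open>Rx\<close> and \<open>x\<close>, followed by AM-GM, gives
  \<open>|\<langle>Tx, x\<rangle>\<^sub>A|\<^sup>2 \<le> |\<langle>T\<^sup>2x, x\<rangle>\<^sub>A| / 2 + (\<parallel>Tx\<parallel>\<^sub>A\<^sup>2 + \<parallel>Rx\<parallel>\<^sub>A\<^sup>2) / 4\<close>. A convex combination, with weight \<open>\<alpha>\<close>, with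
  the Cauchy--Schwarz bound \<open>\<parallel>Tx\<parallel>\<^sub>A\<^sup>2\<close> (for \<open>\<beta>\<^sub>1\<close>) or \<open>\<parallel>Rx\<parallel>\<^sub>A\<^sup>2\<close> (for \<open>\<beta>\<^sub>2\<close>) yields the claim for
  each \<open>\<alpha>\<close>, since \<open>\<parallel>Tx\<parallel>\<^sub>A\<^sup>2 = \<langle>RTx, x\<rangle>\<^sub>A\<close> and \<open>\<parallel>Rx\<parallel>\<^sub>A\<^sup>2 = \<langle>TRx, x\<rangle>\<^sub>A\<close>. The suprema are finite because an
  \<open>A\<close>-adjointable operator is bounded for the seminorm, and the minima over \<open>\<alpha>\<close> are attained because
  the bound is Lipschitz in \<open>\<alpha>\<close>.\<close>

section \<open>Algebra of the complex inner product and of bounded operators\<close>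

lemma complex_sum_real_hermitian:
  assumes "a + b \<in> \<real>" "\<i> * (a - b) \<in> \<real>"
  shows "a = cnj b"
  using assms by (auto simp: complex_is_Real_iff complex_eq_iff)

lemma cinner_scaleC_right:
  "cinner x (c *\<^sub>C y) = cnj c * cinner x (y :: 'a::complex_hilbert_space)"
  by (metis cinner_commute cinner_scaleC_left complex_cnj_mult)

lemma cinner_add_right:
  "cinner x (y + z) = cinner x y + cinner x (z :: 'a::complex_hilbert_space)"
  by (metis cinner_add_left cinner_commute complex_cnj_add)

lemma cinner_scaleR_left: "cinner (r *\<^sub>R x) y = of_real r * cinner x (y :: 'a::complex_hilbert_space)"
  by (simp add: scaleR_scaleC cinner_scaleC_left)

lemma cinner_scaleR_right: "cinner x (r *\<^sub>R y) = of_real r * cinner x (y :: 'a::complex_hilbert_space)"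
  by (simp add: scaleR_scaleC cinner_scaleC_right)

lemma cinner_minus_left: "cinner (- x) y = - cinner x (y :: 'a::complex_hilbert_space)"
  using cinner_scaleR_left[of "-1" x y] by simp

lemma cinner_minus_right: "cinner x (- y) = - cinner x (y :: 'a::complex_hilbert_space)"
  using cinner_scaleR_right[of x "-1" y] by simp

lemma cinner_diff_left: "cinner (x - y) z = cinner x z - cinner y (z :: 'a::complex_hilbert_space)"
  using cinner_add_left[of x "- y" z] by (simp add: cinner_minus_left)

lemma cinner_diff_right: "cinner x (y - z) = cinner x y - cinner x (z :: 'a::complex_hilbert_space)"
  using cinner_add_right[of x y "- z"] by (simp add: cinner_minus_right)

lemmas cinner_linear_simps = cinner_add_left cinner_add_right cinner_diff_left cinner_diff_right
  cinner_scaleC_left cinner_scaleC_right cinner_scaleR_left cinner_scaleR_right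

lemma scaleC_minus1: "(- 1) *\<^sub>C x = - (x :: 'a::complex_hilbert_space)"
  using scaleR_scaleC[of "-1" x] by simp

lemma vector_space_scaleC: "vector_space (scaleC :: complex \<Rightarrow> 'a \<Rightarrow> 'a::complex_hilbert_space)"
  by standard (auto simp: scaleC_add_right scaleC_add_left scaleC_scaleC scaleC_one)

lemma bounded_operatorsI:
  fixes T :: "'a::complex_hilbert_space \<Rightarrow> 'a"
  assumes "\<And>x y. T (x + y) = T x + T y" "\<And>c x. T (c *\<^sub>C x) = c *\<^sub>C T x"
    and "\<And>x. norm (T x) \<le> K * norm x"
  shows "T \<in> bounded_operators"
proof -
  interpret V: vector_space "scaleC :: complex \<Rightarrow> 'a \<Rightarrow> 'a" by (rule vector_space_scaleC)
  have "Vector_Spaces.linear scaleC scaleC T"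
    by (intro Vector_Spaces.linear_iff[THEN iffD2] conjI allI assms vector_space_scaleC)
  then show ?thesis
    using assms(3) unfolding bounded_operators_def by blast
qed

lemma
  assumes "T \<in> bounded_operators"
  shows bounded_operators_add: "T (x + y) = T x + T y"
    and bounded_operators_scaleC: "T (c *\<^sub>C x) = c *\<^sub>C T x"
    and bounded_operators_scaleR: "T (r *\<^sub>R x) = r *\<^sub>R T x"
    and bounded_operators_diff: "T (x - y) = T x - T y"
proof -
  have lin: "Vector_Spaces.linear scaleC scaleC T"
    using assms by (simp add: bounded_operators_def)
  show add: "T (x + y) = T x + T y" for x y
    by (rule Vector_Spaces.linear.axioms(3)[OF lin, THEN module_hom.add])
  show scale: "T (c *\<^sub>C x) = c *\<^sub>C T x" for c x
    by (rule Vector_Spaces.linear.axioms(3)[OF lin, THEN module_hom.scale])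
  show "T (r *\<^sub>R x) = r *\<^sub>R T x"
    by (simp add: scaleR_scaleC scale)
  show "T (x - y) = T x - T y"
    using add[of "x - y" y] by simp
qed

lemma bounded_operators_bound:
  assumes "T \<in> bounded_operators"
  obtains K where "K > 0" "\<And>x. norm (T x) \<le> K * norm x"
proof -
  obtain K where K: "\<And>x. norm (T x) \<le> K * norm x"
    using assms by (auto simp: bounded_operators_def)
  have "norm (T x) \<le> (\<bar>K\<bar> + 1) * norm x" for x
    by (rule order_trans[OF K]) (auto intro!: mult_right_mono)
  then show ?thesis
    by (intro that[of "\<bar>K\<bar> + 1"]) auto
qed

lemma bounded_operators_comp:
  assumes "S \<in> bounded_operators" "T \<in> bounded_operators"
  shows "S \<circ> T \<in> bounded_operators"
proof -
  obtain K where K: "K > 0" "\<And>x. norm (S x) \<le> K * norm x"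
    using bounded_operators_bound[OF assms(1)] by metis
  obtain L where L: "L > 0" "\<And>x. norm (T x) \<le> L * norm x"
    using bounded_operators_bound[OF assms(2)] by metis
  have "norm ((S \<circ> T) x) \<le> (K * L) * norm x" for x
    using order_trans[OF K(2)[of "T x"] mult_left_mono[OF L(2)[of x], of K]] K(1)
    by (simp add: mult.assoc)
  then show ?thesis
    by (intro bounded_operatorsI[where K = "K * L"])
      (auto simp: assms[THEN bounded_operators_add] assms[THEN bounded_operators_scaleC])
qed


section \<open>The semi-inner product\<close>

context
  fixes A :: "'a::complex_hilbert_space \<Rightarrow> 'a"
  assumes pos: "positive_operator A"
begin

lemma positive_operator_bounded: "A \<in> bounded_operators"
  using pos by (simp add: positive_operator_def)

lemmas A_linear = bounded_operators_add[OF positive_operator_bounded]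
  bounded_operators_diff[OF positive_operator_bounded]
  bounded_operators_scaleC[OF positive_operator_bounded]
  bounded_operators_scaleR[OF positive_operator_bounded]

lemma A_inner_linear:
  "A_inner A (x + y) z = A_inner A x z + A_inner A y z"
  "A_inner A x (y + z) = A_inner A x y + A_inner A x z"
  "A_inner A (x - y) z = A_inner A x z - A_inner A y z"
  "A_inner A x (y - z) = A_inner A x y - A_inner A x z"
  "A_inner A (c *\<^sub>C x) y = c * A_inner A x y"
  "A_inner A x (c *\<^sub>C y) = cnj c * A_inner A x y"
  "A_inner A (r *\<^sub>R x) y = of_real r * A_inner A x y"
  "A_inner A x (r *\<^sub>R y) = of_real r * A_inner A x y"
  by (simp_all add: A_inner_def A_linear cinner_linear_simps)

lemma A_inner_self: "A_inner A x x = of_real ((A_norm A x)\<^sup>2)"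
proof -
  have "A_inner A x x \<in> \<real>\<^sub>\<ge>\<^sub>0"
    using pos by (simp add: positive_operator_def A_inner_def)
  then show ?thesis
    by (auto simp: A_norm_def complex_nonneg_Reals_iff complex_eq_iff)
qed

lemma A_norm_nonneg: "A_norm A x \<ge> 0"
  using A_inner_self[of x] pos
  by (simp add: A_norm_def positive_operator_def A_inner_def complex_nonneg_Reals_iff)

text \<open>Polarisation: the form is real at \<open>x + y\<close> and at
  \<open>x - \<i> *\<^sub>C y\<close>, so the sum of the two cross terms and \<open>\<i>\<close>
  times their difference are real, which forces them to be conjugate.\<close>

lemma A_inner_commute: "A_inner A x y = cnj (A_inner A y x)"
proof (rule complex_sum_real_hermitian)
  have "A_inner A (x + y) (x + y) - A_inner A x x - A_inner A y y \<in> \<real>"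
    unfolding A_inner_self by (intro Reals_diff Reals_of_real)
  then show "A_inner A x y + A_inner A y x \<in> \<real>"
    by (simp add: A_inner_linear algebra_simps)
  have "A_inner A (x - \<i> *\<^sub>C y) (x - \<i> *\<^sub>C y) - A_inner A x x - A_inner A y y \<in> \<real>"
    unfolding A_inner_self by (intro Reals_diff Reals_of_real)
  then show "\<i> * (A_inner A x y - A_inner A y x) \<in> \<real>"
    by (simp add: A_inner_linear algebra_simps)
qed

lemma A_inner_Cauchy_Schwarz: "cmod (A_inner A x y) \<le> A_norm A x * A_norm A y"
proof -
  define c where "c = A_inner A x y"
  have c': "A_inner A y x = cnj c"
    using A_inner_commute[of y x] by (simp add: c_def)
  \<comment> \<open>The right side is the squared seminorm of
    \<open>x - (t * c) *\<^sub>C y\<close>; the factor \<open>c\<close> makes the cross term real.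
    The real \<open>t\<close> stays free because the seminorm of \<open>y\<close> may
    vanish.\<close>
  have quad: "0 \<le> (A_norm A x)\<^sup>2 - 2 * t * (cmod c)\<^sup>2 + t\<^sup>2 * (cmod c)\<^sup>2 * (A_norm A y)\<^sup>2" for t
  proof -
    have "A_inner A (x - (t * c) *\<^sub>C y) (x - (t * c) *\<^sub>C y) =
        of_real ((A_norm A x)\<^sup>2) - 2 * t * (c * cnj c) + t\<^sup>2 * (c * cnj c) * of_real ((A_norm A y)\<^sup>2)"
      unfolding A_inner_linear c' A_inner_self[of x] A_inner_self[of y] c_def[symmetric]
      by (simp add: algebra_simps power2_eq_square)
    also have "\<dots> = of_real ((A_norm A x)\<^sup>2 - 2 * t * (cmod c)\<^sup>2 + t\<^sup>2 * (cmod c)\<^sup>2 * (A_norm A y)\<^sup>2)"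
      using complex_norm_square[of c] by simp
    finally show ?thesis
      unfolding A_inner_self of_real_eq_iff by (metis zero_le_power2)
  qed
  have "(cmod c)\<^sup>2 \<le> (A_norm A x)\<^sup>2 * (A_norm A y)\<^sup>2"
  proof (cases "A_norm A y = 0")
    case True
    have "(cmod c)\<^sup>2 = 0"
    proof (rule ccontr)
      assume "(cmod c)\<^sup>2 \<noteq> 0"
      \<comment> \<open>With \<open>A_norm A y = 0\<close> the right side of \<open>quad\<close> is
        affine in \<open>t\<close>, and this \<open>t\<close> gives it the value -1.\<close>
      then show False
        using quad[of "((A_norm A x)\<^sup>2 + 1) / (2 * (cmod c)\<^sup>2)"] True by simp
    qed
    then show ?thesis by simp
  next
    case False
    define n where "n = (A_norm A y)\<^sup>2"
    have "n > 0"
      using False by (simp add: n_def)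
    \<comment> \<open>The quadratic in \<open>t\<close> is minimal at
      \<open>t = 1 / n\<close>.\<close>
    then have "(1 / n)\<^sup>2 * (cmod c)\<^sup>2 * n = (cmod c)\<^sup>2 / n"
      "2 * (1 / n) * (cmod c)\<^sup>2 = 2 * ((cmod c)\<^sup>2 / n)"
      by (simp_all add: power2_eq_square)
    then have "(cmod c)\<^sup>2 / n \<le> (A_norm A x)\<^sup>2"
      using quad[of "1 / n"] unfolding n_def[symmetric] by linarith
    then show ?thesis
      using \<open>n > 0\<close> unfolding n_def[symmetric] by (simp add: pos_divide_le_eq)
  qed
  then show ?thesis
    by (metis A_norm_nonneg abs_of_nonneg c_def mult_nonneg_nonneg power2_le_imp_le power_mult_distrib)
qed

lemma A_norm_power2_add:
  "(A_norm A (x + y))\<^sup>2 = (A_norm A x)\<^sup>2 + 2 * Re (A_inner A x y) + (A_norm A y)\<^sup>2"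
proof -
  have "of_real ((A_norm A (x + y))\<^sup>2) = A_inner A (x + y) (x + y)"
    by (simp add: A_inner_self)
  also have "\<dots> = of_real ((A_norm A x)\<^sup>2) + (A_inner A x y + cnj (A_inner A x y)) + of_real ((A_norm A y)\<^sup>2)"
    unfolding A_inner_linear A_inner_self[of x] A_inner_self[of y] A_inner_commute[of y x]
    by simp
  also have "\<dots> = of_real ((A_norm A x)\<^sup>2 + 2 * Re (A_inner A x y) + (A_norm A y)\<^sup>2)"
    by (simp add: complex_add_cnj)
  finally show ?thesis
    unfolding of_real_eq_iff .
qed

lemma A_norm_triangle: "A_norm A (x + y) \<le> A_norm A x + A_norm A y"
proof (rule power2_le_imp_le)
  show "(A_norm A (x + y))\<^sup>2 \<le> (A_norm A x + A_norm A y)\<^sup>2"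
    using A_inner_Cauchy_Schwarz[of x y] complex_Re_le_cmod[of "A_inner A x y"]
    unfolding A_norm_power2_add power2_sum by linarith
qed (simp add: A_norm_nonneg)

lemma A_norm_scaleC: "A_norm A (c *\<^sub>C x) = cmod c * A_norm A x"
proof -
  have "complex_of_real ((A_norm A (c *\<^sub>C x))\<^sup>2) = of_real ((cmod c * A_norm A x)\<^sup>2)"
    unfolding A_inner_self[symmetric] power_mult_distrib of_real_mult A_inner_linear
      complex_norm_square by (simp add: mult_ac)
  then show ?thesis
    unfolding of_real_eq_iff by (simp add: A_norm_nonneg)
qed

lemma A_norm_scaleR: "A_norm A (r *\<^sub>R x) = \<bar>r\<bar> * A_norm A x"
  by (simp add: scaleR_scaleC A_norm_scaleC)

text \<open>The reflection \<open>2\<langle>x, e\<rangle>e - x\<close> of \<open>x\<close> has the same seminorm as \<open>x\<close>.\<close>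

lemma A_inner_Buzano:
  assumes "A_norm A e = 1"
  shows "cmod (A_inner A x e * A_inner A e y) \<le> (A_norm A x * A_norm A y + cmod (A_inner A x y)) / 2"
proof -
  define z where "z = (2 * A_inner A x e) *\<^sub>C e - x"
  have ex: "A_inner A e x = cnj (A_inner A x e)"
    by (rule A_inner_commute)
  have "A_inner A z z = A_inner A x x"
    by (simp add: z_def A_inner_linear ex) (simp add: A_inner_self assms algebra_simps)
  then have "A_norm A z = A_norm A x"
    by (simp add: A_norm_def)
  then have "cmod (A_inner A z y) \<le> A_norm A x * A_norm A y"
    using A_inner_Cauchy_Schwarz[of z y] by simp
  \<comment> \<open>The product is the average of \<open>A_inner A z y\<close> and
    \<open>A_inner A x y\<close>; only the first is estimated by Cauchy-Schwarz.\<close>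
  moreover have "2 * (A_inner A x e * A_inner A e y) = A_inner A z y + A_inner A x y"
    by (simp add: z_def A_inner_linear)
  ultimately show ?thesis
    using norm_triangle_ineq[of "A_inner A z y" "A_inner A x y"]
      norm_mult[of 2 "A_inner A x e * A_inner A e y"] by simp
qed

end

section \<open>The Hilbert norm as the seminorm of the identity operator\<close>

lemma positive_operator_id: "positive_operator (\<lambda>x. x :: 'a::complex_hilbert_space)"
  by (auto simp: positive_operator_def cinner_nonneg intro: bounded_operatorsI[where K = 1])

lemma A_norm_id: "A_norm (\<lambda>x. x) = norm"
  by (simp add: fun_eq_iff A_norm_def A_inner_def norm_eq_sqrt_cinner)

lemma norm_cinner_le: "cmod (cinner x y) \<le> norm x * norm y"
  using A_inner_Cauchy_Schwarz[OF positive_operator_id, of x y]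
  by (simp add: A_norm_id A_inner_def)

lemma norm_power2_add: "(norm (x + y))\<^sup>2 = (norm x)\<^sup>2 + 2 * Re (cinner x y) + (norm y)\<^sup>2"
  using A_norm_power2_add[OF positive_operator_id, of x y] by (simp add: A_norm_id A_inner_def)

lemma norm_scaleC: "norm (c *\<^sub>C x) = cmod c * norm x"
  using A_norm_scaleC[OF positive_operator_id, of c x] by (simp add: A_norm_id)

lemma bounded_linear_cinner_left: "bounded_linear (\<lambda>x. cinner x y)"
  by (rule bounded_linear_intro[where K = "norm y"])
    (auto simp: cinner_linear_simps norm_cinner_le scaleR_conv_of_real)

lemma parallelogram_law:
  fixes x y :: "'a::complex_hilbert_space"
  shows "(norm (x + y))\<^sup>2 + (norm (x - y))\<^sup>2 = 2 * (norm x)\<^sup>2 + 2 * (norm y)\<^sup>2"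
  using norm_power2_add[of x y] norm_power2_add[of x "- y"] by (simp add: cinner_minus_right)


section \<open>Orthogonal projection and the distinguished adjoint\<close>

text \<open>Later instantiated with the closure of \<open>range A\<close>, onto which an arbitrary
  \<open>A\<close>-adjoint is projected.\<close>

locale closed_csubspace =
  fixes M :: "'a::complex_hilbert_space set"
  assumes closed: "closed M" and zero: "0 \<in> M"
    and add: "\<And>x y. x \<in> M \<Longrightarrow> y \<in> M \<Longrightarrow> x + y \<in> M"
    and scaleC: "\<And>c x. x \<in> M \<Longrightarrow> c *\<^sub>C x \<in> M"
begin

lemma scaleR: "x \<in> M \<Longrightarrow> r *\<^sub>R x \<in> M"
  by (simp add: scaleR_scaleC scaleC)

lemma diff: "x \<in> M \<Longrightarrow> y \<in> M \<Longrightarrow> x - y \<in> M"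
  using add[of x "- y"] scaleC[of y "-1"] by (simp add: scaleC_minus1)

text \<open>A sequence in \<open>M\<close> that minimises the distance to \<open>x\<close> is Cauchy
  by the parallelogram law; completeness gives a limit and closedness keeps it in
  \<open>M\<close>.\<close>

lemma nearest_point_exists:
  obtains m where "m \<in> M" "\<And>y. y \<in> M \<Longrightarrow> norm (x - m) \<le> norm (x - y)"
proof -
  define d where "d = Inf ((\<lambda>y. norm (x - y)) ` M)"
  have bdd: "bdd_below ((\<lambda>y. norm (x - y)) ` M)"
    by (auto intro: bdd_belowI[where m = 0])
  have d_le: "d \<le> norm (x - y)" if "y \<in> M" for y
    unfolding d_def using that bdd by (intro cInf_lower) auto
  have d_nonneg: "d \<ge> 0"
    unfolding d_def using zero by (intro cInf_greatest) auto
  have "\<exists>y\<in>M. norm (x - y) < d + inverse (real (Suc n))" for n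
    using cInf_lessD[of "(\<lambda>y. norm (x - y)) ` M" "d + inverse (real (Suc n))"] zero
    by (auto simp: d_def)
  then obtain m where mM: "\<And>n. m n \<in> M" and m: "\<And>n. norm (x - m n) < d + inverse (real (Suc n))"
    by metis
  have lim: "(\<lambda>n. norm (x - m n)) \<longlonglongrightarrow> d"
  proof (rule tendsto_sandwich[of "\<lambda>_. d"])
    show "(\<lambda>n. d + inverse (real (Suc n))) \<longlonglongrightarrow> d"
      using tendsto_add[OF tendsto_const[of d] LIMSEQ_inverse_real_of_nat] by simp
  qed (use m d_le mM in \<open>auto intro!: always_eventually simp: less_imp_le\<close>)
  \<comment> \<open>Parallelogram law for \<open>x - m i\<close> and \<open>x - m j\<close>: half
    their sum is \<open>x\<close> minus a midpoint in \<open>M\<close>, hence has norm at least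
    \<open>d\<close>.\<close>
  have dist_le: "(norm (m i - m j))\<^sup>2 \<le> 2 * ((norm (x - m i))\<^sup>2 - d\<^sup>2) + 2 * ((norm (x - m j))\<^sup>2 - d\<^sup>2)" for i j
  proof -
    have "x - m i + (x - m j) = 2 *\<^sub>R (x - (1/2) *\<^sub>R (m i + m j))"
      by (simp add: algebra_simps scaleR_2)
    then have "norm (x - m i + (x - m j)) = 2 * norm (x - (1/2) *\<^sub>R (m i + m j))"
      by simp
    moreover have "d\<^sup>2 \<le> (norm (x - (1/2) *\<^sub>R (m i + m j)))\<^sup>2"
      by (intro power_mono d_le scaleR add mM d_nonneg)
    ultimately have "4 * d\<^sup>2 \<le> (norm (x - m i + (x - m j)))\<^sup>2"
      by (simp add: power_mult_distrib)
    then show ?thesis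
      using parallelogram_law[of "x - m i" "x - m j"] by (simp add: norm_minus_commute)
  qed
  have "Cauchy m"
  proof (rule metric_CauchyI)
    fix e :: real assume "e > 0"
    have "(\<lambda>n. (norm (x - m n))\<^sup>2 - d\<^sup>2) \<longlonglongrightarrow> d\<^sup>2 - d\<^sup>2"
      by (intro tendsto_intros lim)
    \<comment> \<open>Two terms, each doubled in \<open>dist_le\<close>, account for the quarter of
      \<open>e\<^sup>2\<close>.\<close>
    then have "\<forall>\<^sub>F n in sequentially. (norm (x - m n))\<^sup>2 - d\<^sup>2 < e\<^sup>2 / 4"
      using \<open>e > 0\<close> by (intro order_tendstoD(2)[where y = "d\<^sup>2 - d\<^sup>2"]) auto
    then obtain N where N: "\<And>n. n \<ge> N \<Longrightarrow> (norm (x - m n))\<^sup>2 - d\<^sup>2 < e\<^sup>2 / 4"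
      by (auto simp: eventually_sequentially)
    have "dist (m i) (m j) < e" if "i \<ge> N" "j \<ge> N" for i j
    proof -
      have "(norm (m i - m j))\<^sup>2 < e\<^sup>2"
        by (rule le_less_trans[OF dist_le]) (use N[OF that(1)] N[OF that(2)] in argo)
      then show ?thesis
        using \<open>e > 0\<close> by (simp add: dist_norm power_less_imp_less_base)
    qed
    then show "\<exists>N. \<forall>i\<ge>N. \<forall>j\<ge>N. dist (m i) (m j) < e"
      by blast
  qed
  then obtain l where l: "m \<longlonglongrightarrow> l"
    by (auto simp: Cauchy_convergent_iff convergent_def)
  have "l \<in> M"
    using closed_sequentially[OF closed _ l] mM by blast
  moreover have "norm (x - l) = d"
    using lim by (rule LIMSEQ_unique[rotated]) (intro tendsto_intros l)
  ultimately show ?thesis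
    using d_le that by metis
qed

text \<open>Moving the nearest point \<open>m\<close> by a small multiple of \<open>y\<close> cannot
  bring it closer to \<open>x\<close>, so the first-order term of the squared distance, a multiple
  of the squared modulus of the inner product, must vanish.\<close>

lemma projection_exists:
  obtains m where "m \<in> M" "\<And>y. y \<in> M \<Longrightarrow> cinner (x - m) y = 0"
proof -
  obtain m where m: "m \<in> M" "\<And>y. y \<in> M \<Longrightarrow> norm (x - m) \<le> norm (x - y)"
    using nearest_point_exists by metis
  have "cinner (x - m) y = 0" if y: "y \<in> M" for y
  proof -
    define c where "c = cinner (x - m) y"
    \<comment> \<open>The added 1 allows \<open>y = 0\<close> and keeps
      \<open>t * (norm y)\<^sup>2\<close> below 1, so the quadratic term cannot outweigh the linear
      one.\<close>
    define t where "t = 1 / ((norm y)\<^sup>2 + 1)"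
    have t: "t > 0" "t * (norm y)\<^sup>2 < 1"
      by (auto simp: t_def add_nonneg_pos)
    have neg: "(- (of_real t * c)) *\<^sub>C y = - ((of_real t * c) *\<^sub>C y)"
      using scaleC_scaleC[of "-1" "of_real t * c" y] by (simp add: scaleC_minus1)
    have "norm (x - m) \<le> norm (x - m + (- (t * c)) *\<^sub>C y)"
      using m(2)[of "m + (t * c) *\<^sub>C y"] add[OF m(1) scaleC[OF y]]
      by (simp add: neg diff_diff_eq)
    then have "(norm (x - m))\<^sup>2 \<le> (norm (x - m + (- (t * c)) *\<^sub>C y))\<^sup>2"
      by (intro power_mono) auto
    also have "\<dots> = (norm (x - m))\<^sup>2 - 2 * t * (cmod c)\<^sup>2 + t\<^sup>2 * (cmod c)\<^sup>2 * (norm y)\<^sup>2"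
    proof -
      have "cinner (x - m) ((- (t * c)) *\<^sub>C y) = - of_real (t * (cmod c)\<^sup>2)"
        unfolding cinner_scaleC_right c_def[symmetric]
        using complex_norm_square[of c] by (simp add: mult_ac)
      then show ?thesis
        unfolding norm_power2_add norm_scaleC
        by (simp add: power_mult_distrib norm_mult)
    qed
    finally have "0 \<le> t * (cmod c)\<^sup>2 * (t * (norm y)\<^sup>2 - 2)"
      by (simp add: algebra_simps power2_eq_square)
    then have "(cmod c)\<^sup>2 = 0"
      using t by (smt (verit) mult_pos_neg mult_pos_pos zero_le_power2)
    then show ?thesis by (simp add: c_def)
  qed
  then show ?thesis
    using m(1) that by blast
qed

definition proj :: "'a \<Rightarrow> 'a"
  where "proj x = (SOME m. m \<in> M \<and> (\<forall>y\<in>M. cinner (x - m) y = 0))"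

lemma
  shows proj_in: "proj x \<in> M"
    and proj_orthogonal: "y \<in> M \<Longrightarrow> cinner (x - proj x) y = 0"
proof -
  have "\<exists>m. m \<in> M \<and> (\<forall>y\<in>M. cinner (x - m) y = 0)"
    using projection_exists by metis
  from someI_ex[OF this] show "proj x \<in> M" "y \<in> M \<Longrightarrow> cinner (x - proj x) y = 0"
    by (auto simp: proj_def)
qed

lemma proj_unique:
  assumes "m \<in> M" "\<And>y. y \<in> M \<Longrightarrow> cinner (x - m) y = 0"
  shows "proj x = m"
proof -
  have "m - proj x \<in> M"
    by (intro diff assms proj_in)
  then have "cinner (m - proj x) (m - proj x) = 0"
    using assms(2) proj_orthogonal[of _ x]
    by (metis (no_types, lifting) cinner_diff_left diff_self right_minus_eq)
  then show ?thesis
    by (simp add: cinner_eq_zero_iff)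
qed

lemma norm_proj_le: "norm (proj x) \<le> norm x"
proof (rule power2_le_imp_le)
  have "(norm x)\<^sup>2 = (norm (x - proj x))\<^sup>2 + (norm (proj x))\<^sup>2"
    using norm_power2_add[of "x - proj x" "proj x"] proj_orthogonal[OF proj_in, of x x] by simp
  then show "(norm (proj x))\<^sup>2 \<le> (norm x)\<^sup>2" by simp
qed simp

text \<open>Linearity follows from uniqueness: sums and multiples of projections lie in
  \<open>M\<close> and leave a remainder orthogonal to \<open>M\<close>.\<close>

lemma proj_bounded_operator: "proj \<in> bounded_operators"
proof (rule bounded_operatorsI[where K = 1])
  fix x y c
  show "proj (x + y) = proj x + proj y"
  proof (rule proj_unique)
    show "cinner (x + y - (proj x + proj y)) z = 0" if "z \<in> M" for z
      using proj_orthogonal[OF that, of x] proj_orthogonal[OF that, of y]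
      by (simp add: cinner_linear_simps)
  qed (intro add proj_in)
  show "proj (c *\<^sub>C x) = c *\<^sub>C proj x"
  proof (rule proj_unique)
    show "cinner (c *\<^sub>C x - c *\<^sub>C proj x) z = 0" if "z \<in> M" for z
      using proj_orthogonal[OF that, of x] by (simp add: cinner_linear_simps)
  qed (intro scaleC proj_in)
  show "norm (proj x) \<le> 1 * norm x"
    using norm_proj_le by simp
qed

end

lemma closed_csubspace_closure_range:
  assumes A: "A \<in> bounded_operators"
  shows "closed_csubspace (closure (range A))"
proof
  show "closed (closure (range A))" by simp
  have "A 0 = 0"
    using bounded_operators_diff[OF A, of 0 0] by simp
  then show "0 \<in> closure (range A)"
    by (metis closure_subset rangeI subsetD)
next
  fix x y assume "x \<in> closure (range A)" "y \<in> closure (range A)"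
  then obtain f g where fg: "\<And>n. f n \<in> range A" "f \<longlonglongrightarrow> x" "\<And>n. g n \<in> range A" "g \<longlonglongrightarrow> y"
    by (auto simp: closure_sequential)
  have "f n + g n \<in> range A" for n
    using fg(1)[of n] fg(3)[of n] by (auto simp flip: bounded_operators_add[OF A])
  then show "x + y \<in> closure (range A)"
    unfolding closure_sequential using tendsto_add[OF fg(2,4)]
    by (intro exI[of _ "\<lambda>n. f n + g n"]) simp
next
  fix c x assume x: "x \<in> closure (range A)"
  have "bounded_linear (\<lambda>x::'a. c *\<^sub>C x)"
    by (rule bounded_linear_intro[where K = "cmod c"])
      (auto simp: scaleC_add_right scaleR_scaleC scaleC_scaleC norm_scaleC mult.commute)
  from closure_bounded_linear_image_subset[OF this]
  have "(\<lambda>x. c *\<^sub>C x) ` closure (range A) \<subseteq> closure ((\<lambda>x. c *\<^sub>C x) ` range A)" .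
  also have "(\<lambda>x. c *\<^sub>C x) ` range A \<subseteq> range A"
    by (auto simp flip: bounded_operators_scaleC[OF A])
  then have "closure ((\<lambda>x. c *\<^sub>C x) ` range A) \<subseteq> closure (range A)"
    by (rule closure_mono)
  finally show "c *\<^sub>C x \<in> closure (range A)"
    using x by blast
qed

text \<open>The map \<open>\<lambda>x. cinner x d\<close> is continuous, so its zero set is closed.
  Used with \<open>S = range A\<close> to prove that the distinguished adjoint is unique.\<close>

lemma cinner_closure_eq_zero:
  assumes "\<And>y. y \<in> S \<Longrightarrow> cinner y d = 0" "x \<in> closure S"
  shows "cinner x d = 0"
proof -
  have "closed {x. cinner x d = 0}"
    by (intro closed_Collect_eq bounded_linear.continuous_on[OF bounded_linear_cinner_left]
        continuous_intros)
  moreover have "S \<subseteq> {x. cinner x d = 0}"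
    using assms by auto
  ultimately show ?thesis
    using assms(2) closure_minimal by blast
qed

text \<open>Existence: projecting any \<open>A\<close>-adjoint onto the closure of
  \<open>range A\<close> only discards a part orthogonal to every \<open>A x\<close>. Uniqueness:
  the difference of two candidates lies in that closure and is orthogonal to it, hence to itself. So
  the definite description in \<open>sharp\<close> denotes.\<close>

lemma sharp_is_A_adjoint:
  assumes "positive_operator A" "T \<in> A_adjointable A"
  shows "is_A_adjoint A T (sharp A T)"
proof -
  have A: "A \<in> bounded_operators"
    using assms(1) by (rule positive_operator_bounded)
  interpret M: closed_csubspace "closure (range A)"
    by (rule closed_csubspace_closure_range[OF A])
  obtain R where R: "is_A_adjoint A T R"
    using assms(2) by (auto simp: A_adjointable_def)
  have proj: "A_inner A x (M.proj y) = A_inner A x y" for x y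
  proof -
    have "A x \<in> closure (range A)"
      by (rule subsetD[OF closure_subset]) simp
    from M.proj_orthogonal[OF this, of y] have "cinner (A x) (y - M.proj y) = 0"
      using cinner_commute[of "A x" "y - M.proj y"] by simp
    then show ?thesis
      by (simp add: A_inner_def cinner_diff_right)
  qed
  have ex: "is_A_adjoint A T (M.proj \<circ> R)"
    using R by (simp add: is_A_adjoint_def proj bounded_operators_comp M.proj_bounded_operator)
  have range: "range (M.proj \<circ> R) \<subseteq> closure (range A)"
    using M.proj_in by auto
  have unique: "R1 = R2"
    if R1: "is_A_adjoint A T R1" "range R1 \<subseteq> closure (range A)"
      and R2: "is_A_adjoint A T R2" "range R2 \<subseteq> closure (range A)" for R1 R2
  proof
    fix y
    have "A_inner A x (R1 y) = A_inner A x (R2 y)" for x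
      using R1(1) R2(1) by (simp add: is_A_adjoint_def)
    then have "cinner z (R1 y - R2 y) = 0" if "z \<in> range A" for z
      using that by (auto simp: A_inner_def cinner_diff_right)
    moreover have "R1 y - R2 y \<in> closure (range A)"
      using R1(2) R2(2) by (intro M.diff) auto
    ultimately have "cinner (R1 y - R2 y) (R1 y - R2 y) = 0"
      by (rule cinner_closure_eq_zero)
    then show "R1 y = R2 y"
      by (simp add: cinner_eq_zero_iff)
  qed
  have "\<exists>!R. is_A_adjoint A T R \<and> range R \<subseteq> closure (range A)"
    by (intro ex1I[of _ "M.proj \<circ> R"] conjI ex range) (elim conjE, rule unique[OF _ _ ex range])
  from theI'[OF this] show ?thesis
    by (simp add: sharp_def)
qed


section \<open>Boundedness in the seminorm\<close>

text \<open>If \<open>a > K\<close>, the powers of \<open>a / K\<close> exceed every constant. As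
  \<open>C\<close> leaves no trace in the conclusion, it may depend on the vector to which the bound
  is applied.\<close>

lemma power_bound_imp_le:
  fixes a C K :: real
  assumes "0 \<le> a" "0 < K" and le: "\<And>n. a ^ (2 ^ n) \<le> C * K ^ (2 ^ n)"
  shows "a \<le> K"
proof (rule ccontr)
  assume "\<not> a \<le> K"
  define q where "q = a / K"
  have "q > 1"
    using \<open>\<not> a \<le> K\<close> \<open>0 < K\<close> by (simp add: q_def)
  then obtain n where "C < q ^ n"
    using real_arch_pow by blast
  also have "\<dots> \<le> q ^ (2 ^ n)"
    using \<open>q > 1\<close> by (intro power_increasing less_imp_le[OF less_exp]) simp
  also have "\<dots> \<le> C"
    using le[of n] \<open>0 < K\<close> by (simp add: q_def power_divide divide_le_eq)
  finally show False by simp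
qed

text \<open>Hermitian symmetry of the semi-inner product lets \<open>T\<close> and \<open>R\<close>
  exchange roles.\<close>

lemma is_A_adjoint_swap:
  assumes "positive_operator A" "is_A_adjoint A T R"
  shows "A_inner A (R x) y = A_inner A x (T y)"
proof -
  have "A_inner A (R x) y = cnj (A_inner A y (R x))"
    by (rule A_inner_commute[OF assms(1)])
  also have "\<dots> = cnj (A_inner A (T y) x)"
    using assms(2) by (simp add: is_A_adjoint_def)
  also have "\<dots> = A_inner A x (T y)"
    by (rule A_inner_commute[OF assms(1), symmetric])
  finally show ?thesis .
qed

text \<open>For an \<open>A\<close>-selfadjoint \<open>S\<close>, Cauchy--Schwarz gives \<open>\<parallel>Sx\<parallel>\<^sub>A\<^sup>2 \<le> \<parallel>x\<parallel>\<^sub>A \<parallel>S\<^sup>2x\<parallel>\<^sub>A\<close>; iterating along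
  the powers \<open>S\<^bsup>2^n\<^esup>\<close> compares the seminorm with the norm of \<open>S\<close>.\<close>

lemma A_selfadjoint_bounded:
  assumes pos: "positive_operator A" and adj: "is_A_adjoint A S S"
  obtains K where "K > 0" "\<And>x. A_norm A (S x) \<le> K * A_norm A x"
proof -
  have S: "S \<in> bounded_operators"
    using adj by (simp add: is_A_adjoint_def)
  obtain K where K: "K > 0" "\<And>x. norm (S x) \<le> K * norm x"
    using bounded_operators_bound[OF S] by metis
  obtain L where L: "L > 0" "\<And>x. norm (A x) \<le> L * norm x"
    using bounded_operators_bound[OF positive_operator_bounded[OF pos]] by metis
  \<comment> \<open>Boundedness of \<open>A\<close> makes the norm dominate the seminorm; no
    converse estimate is available.\<close>
  have A_norm_le: "A_norm A x \<le> sqrt L * norm x" for x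
  proof -
    have "Re (A_inner A x x) \<le> norm (A x) * norm x"
      unfolding A_inner_def using complex_Re_le_cmod norm_cinner_le order_trans by blast
    also have "\<dots> \<le> L * norm x * norm x"
      by (intro mult_right_mono L) auto
    finally have "A_norm A x \<le> sqrt (L * (norm x)\<^sup>2)"
      unfolding A_norm_def by (simp add: power2_eq_square mult.assoc)
    then show ?thesis
      by (simp add: real_sqrt_mult)
  qed
  have pow_adj: "A_inner A ((S ^^ k) x) y = A_inner A x ((S ^^ k) y)" for k x y
  proof (induction k arbitrary: x y)
    case (Suc k)
    then show ?case
      using adj by (simp add: is_A_adjoint_def funpow_swap1)
  qed simp
  have step: "(A_norm A ((S ^^ k) x))\<^sup>2 \<le> A_norm A x * A_norm A ((S ^^ (2 * k)) x)" for k x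
  proof -
    have "A_inner A ((S ^^ k) x) ((S ^^ k) x) = A_inner A x ((S ^^ (2 * k)) x)"
      by (simp add: pow_adj mult_2 funpow_add)
    then have "(A_norm A ((S ^^ k) x))\<^sup>2 = cmod (A_inner A x ((S ^^ (2 * k)) x))"
      by (metis A_inner_self[OF pos] abs_of_nonneg norm_of_real zero_le_power2)
    then show ?thesis
      using A_inner_Cauchy_Schwarz[OF pos] by metis
  qed
  \<comment> \<open>The factor \<open>sqrt L * norm x\<close> depends on \<open>x\<close>, but it is
    not raised to the power \<open>2 ^ n\<close>, so comparing powers removes it and leaves the
    uniform bound \<open>K\<close>.\<close>
  have unit: "A_norm A (S x) \<le> K" if x: "A_norm A x = 1" for x
  proof (rule power_bound_imp_le[where C = "sqrt L * norm x"])
    fix n :: nat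
    have "A_norm A (S x) ^ (2 ^ n) \<le> A_norm A ((S ^^ (2 ^ n)) x)"
    proof (induction n)
      case (Suc n)
      have "A_norm A (S x) ^ (2 ^ Suc n) = (A_norm A (S x) ^ (2 ^ n))\<^sup>2"
        by (simp add: mult.commute flip: power_mult)
      also have "\<dots> \<le> (A_norm A ((S ^^ (2 ^ n)) x))\<^sup>2"
        by (intro power_mono Suc zero_le_power A_norm_nonneg[OF pos])
      also have "\<dots> \<le> A_norm A ((S ^^ (2 ^ Suc n)) x)"
        using step[of "2 ^ n" x] x by simp
      finally show ?case .
    qed simp
    also have "\<dots> \<le> sqrt L * norm ((S ^^ (2 ^ n)) x)"
      by (rule A_norm_le)
    also have "norm ((S ^^ k) x) \<le> K ^ k * norm x" for k
    proof (induction k)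
      case (Suc k)
      then have "K * norm ((S ^^ k) x) \<le> K * (K ^ k * norm x)"
        using K(1) by simp
      then show ?case
        using K(2)[of "(S ^^ k) x"] by (simp add: mult.assoc)
    qed simp
    then have "sqrt L * norm ((S ^^ (2 ^ n)) x) \<le> sqrt L * (K ^ (2 ^ n) * norm x)"
      using L(1) by (intro mult_left_mono) auto
    finally show "A_norm A (S x) ^ (2 ^ n) \<le> sqrt L * norm x * K ^ (2 ^ n)"
      by (simp add: mult_ac)
  qed (use K A_norm_nonneg[OF pos] in auto)
  have "A_norm A (S x) \<le> K * A_norm A x" for x
  proof (cases "A_norm A x = 0")
    \<comment> \<open>A null vector cannot be normalised; \<open>step\<close> with
      \<open>k = 1\<close> shows that its image is null as well.\<close>
    case True
    then show ?thesis
      using step[of 1 x] by simp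
  next
    case False
    then have n: "A_norm A x > 0"
      using A_norm_nonneg[OF pos, of x] by simp
    have "A_norm A (S ((1 / A_norm A x) *\<^sub>R x)) \<le> K"
      using n by (intro unit) (simp add: A_norm_scaleR[OF pos])
    then show ?thesis
      using n by (simp add: bounded_operators_scaleR[OF S] A_norm_scaleR[OF pos] divide_le_eq)
  qed
  then show ?thesis
    using K(1) that by blast
qed

text \<open>The operator \<open>R \<circ> T\<close> is \<open>A\<close>-selfadjoint, hence bounded
  for the seminorm, and the squared seminorm of \<open>T x\<close> is
  \<open>A_inner A x (R (T x))\<close>.\<close>

lemma A_adjoint_bounded:
  assumes pos: "positive_operator A" and T: "T \<in> bounded_operators" and adj: "is_A_adjoint A T R"
  obtains K where "K \<ge> 0" "\<And>x. A_norm A (T x) \<le> K * A_norm A x"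
proof -
  have "is_A_adjoint A (R \<circ> T) (R \<circ> T)"
    using adj T is_A_adjoint_swap[OF pos adj]
    by (auto simp: is_A_adjoint_def intro: bounded_operators_comp)
  then obtain K where K: "K > 0" "\<And>x. A_norm A ((R \<circ> T) x) \<le> K * A_norm A x"
    using A_selfadjoint_bounded[OF pos] by metis
  have "A_norm A (T x) \<le> sqrt K * A_norm A x" for x
  proof (rule power2_le_imp_le)
    have "A_inner A (T x) (T x) = A_inner A x (R (T x))"
      using adj by (simp add: is_A_adjoint_def)
    then have "(A_norm A (T x))\<^sup>2 = cmod (A_inner A x (R (T x)))"
      by (metis A_inner_self[OF pos] abs_of_nonneg norm_of_real zero_le_power2)
    also have "\<dots> \<le> A_norm A x * A_norm A (R (T x))"
      by (rule A_inner_Cauchy_Schwarz[OF pos])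
    also have "\<dots> \<le> A_norm A x * (K * A_norm A x)"
      using K(2)[of x] by (intro mult_left_mono A_norm_nonneg[OF pos]) simp
    finally show "(A_norm A (T x))\<^sup>2 \<le> (sqrt K * A_norm A x)\<^sup>2"
      using K(1) by (simp add: power_mult_distrib power2_eq_square[of "A_norm A x"] mult_ac)
  qed (use K(1) A_norm_nonneg[OF pos] in simp)
  then show ?thesis
    using that[of "sqrt K"] K(1) by simp
qed

section \<open>Suprema over unit vectors and minima over the parameter\<close>

lemma A_norm_le_seminorm:
  assumes "\<And>x. A_norm A x = 1 \<Longrightarrow> A_norm A (P x) \<le> K" "A_norm A x = 1"
  shows "A_norm A (P x) \<le> A_op_seminorm A P"
  unfolding A_op_seminorm_def using assms
  \<comment> \<open>A real supremum is an upper bound only for a set bounded above;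
    \<open>max 0 K\<close> also covers the inserted 0.\<close>
  by (intro cSup_upper bdd_aboveI[where M = "max 0 K"]) (auto simp: le_max_iff_disj)

lemma cmod_A_inner_le_numerical_radius:
  assumes "\<And>x. A_norm A x = 1 \<Longrightarrow> cmod (A_inner A (P x) x) \<le> K" "A_norm A x = 1"
  shows "cmod (A_inner A (P x) x) \<le> A_numerical_radius A P"
  unfolding A_numerical_radius_def using assms
  by (intro cSup_upper bdd_aboveI[where M = "max 0 K"]) (auto simp: le_max_iff_disj)

lemma A_op_seminorm_leI:
  assumes "0 \<le> c" "\<And>x. A_norm A x = 1 \<Longrightarrow> A_norm A (P x) \<le> c"
  shows "A_op_seminorm A P \<le> c"
  unfolding A_op_seminorm_def using assms by (intro cSup_least) auto

lemma A_op_seminorm_nonneg: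
  assumes "\<And>x. A_norm A x = 1 \<Longrightarrow> A_norm A (P x) \<le> K"
  shows "0 \<le> A_op_seminorm A P"
  unfolding A_op_seminorm_def using assms
  by (intro cSup_upper bdd_aboveI[where M = "max 0 K"]) (auto simp: le_max_iff_disj)

lemma A_numerical_radius_nonneg:
  assumes "\<And>x. A_norm A x = 1 \<Longrightarrow> cmod (A_inner A (P x) x) \<le> K"
  shows "0 \<le> A_numerical_radius A P"
  unfolding A_numerical_radius_def using assms
  by (intro cSup_upper bdd_aboveI[where M = "max 0 K"]) (auto simp: le_max_iff_disj)

lemma A_numerical_radius_leI:
  assumes "0 \<le> c" "\<And>x. A_norm A x = 1 \<Longrightarrow> cmod (A_inner A (P x) x) \<le> c"
  shows "A_numerical_radius A P \<le> c"
  unfolding A_numerical_radius_def using assms by (intro cSup_least) auto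

lemma A_op_seminorm_combination_bound:
  assumes pos: "positive_operator A"
    and U: "\<And>x. A_norm A x = 1 \<Longrightarrow> A_norm A (U x) \<le> K"
    and V: "\<And>x. A_norm A x = 1 \<Longrightarrow> A_norm A (V x) \<le> L"
    and x: "A_norm A x = 1"
  shows "A_norm A (a *\<^sub>R U x + b *\<^sub>R V x) \<le> \<bar>a\<bar> * K + \<bar>b\<bar> * L"
proof -
  have "A_norm A (a *\<^sub>R U x + b *\<^sub>R V x) \<le> \<bar>a\<bar> * A_norm A (U x) + \<bar>b\<bar> * A_norm A (V x)"
    using A_norm_triangle[OF pos, of "a *\<^sub>R U x" "b *\<^sub>R V x"] by (simp add: A_norm_scaleR[OF pos])
  also have "\<dots> \<le> \<bar>a\<bar> * K + \<bar>b\<bar> * L"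
    using U[OF x] V[OF x] by (intro add_mono mult_left_mono) auto
  finally show ?thesis .
qed

text \<open>Triangle inequality, with the combination split into the primed one and the one formed
  with the differences of the coefficients. Applied in both directions it gives continuity in the
  coefficients.\<close>

lemma A_op_seminorm_combination_Lipschitz:
  assumes pos: "positive_operator A"
    and U: "\<And>x. A_norm A x = 1 \<Longrightarrow> A_norm A (U x) \<le> K"
    and V: "\<And>x. A_norm A x = 1 \<Longrightarrow> A_norm A (V x) \<le> L"
    and KL: "K \<ge> 0" "L \<ge> 0"
  shows "A_op_seminorm A (\<lambda>x. a *\<^sub>R U x + b *\<^sub>R V x) \<le>
    A_op_seminorm A (\<lambda>x. a' *\<^sub>R U x + b' *\<^sub>R V x) + (\<bar>a - a'\<bar> * K + \<bar>b - b'\<bar> * L)"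
    (is "?l \<le> ?r + ?e")
proof (rule A_op_seminorm_leI)
  note bound = A_op_seminorm_combination_bound[of A U K V L, OF pos U V]
  have "0 \<le> ?r"
    by (rule A_op_seminorm_nonneg) (rule bound)
  then show "0 \<le> ?r + ?e"
    using KL by simp
  fix x assume x: "A_norm A x = 1"
  have "a *\<^sub>R U x + b *\<^sub>R V x =
      (a' *\<^sub>R U x + b' *\<^sub>R V x) + ((a - a') *\<^sub>R U x + (b - b') *\<^sub>R V x)"
    by (simp add: algebra_simps)
  then have "A_norm A (a *\<^sub>R U x + b *\<^sub>R V x) \<le> A_norm A (a' *\<^sub>R U x + b' *\<^sub>R V x) +
      A_norm A ((a - a') *\<^sub>R U x + (b - b') *\<^sub>R V x)"
    using A_norm_triangle[OF pos] by metis
  also have "\<dots> \<le> ?r + ?e"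
    by (intro add_mono A_norm_le_seminorm[OF _ x, where K = "\<bar>a'\<bar> * K + \<bar>b'\<bar> * L"] bound x)
  finally show "A_norm A (a *\<^sub>R U x + b *\<^sub>R V x) \<le> ?r + ?e" .
qed

text \<open>\<open>LEAST\<close> on the reals is informative only if the minimum is attained;
  compactness of the interval ensures this.\<close>

lemma le_LEAST_image_continuous:
  fixes f :: "real \<Rightarrow> real"
  assumes "continuous_on {0..1} f" "\<And>t. t \<in> {0..1} \<Longrightarrow> w \<le> f t"
  shows "w \<le> (LEAST b. \<exists>t\<in>{0..1}. b = f t)"
proof -
  obtain t where "t \<in> {0..1}" "\<And>s. s \<in> {0..1} \<Longrightarrow> f t \<le> f s"
    using continuous_attains_inf[OF _ _ assms(1)] by auto
  then have "(LEAST b. \<exists>t\<in>{0..1}. b = f t) = f t"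
    by (intro Least_equality) auto
  then show ?thesis
    using assms(2) \<open>t \<in> {0..1}\<close> by simp
qed

text \<open>The Lipschitz estimate makes the seminorm term continuous in \<open>t\<close>. The
  coefficients are kept general so that \<open>beta1\<close> and \<open>beta2\<close> are both
  instances.\<close>

lemma le_LEAST_seminorm_combination:
  fixes a b :: "real \<Rightarrow> real"
  assumes pos: "positive_operator A"
    and U: "\<And>x. A_norm A x = 1 \<Longrightarrow> A_norm A (U x) \<le> K"
    and V: "\<And>x. A_norm A x = 1 \<Longrightarrow> A_norm A (V x) \<le> L"
    and KL: "K \<ge> 0" "L \<ge> 0"
    and cont: "continuous_on {0..1} a" "continuous_on {0..1} b"
    and le: "\<And>t. t \<in> {0..1} \<Longrightarrow> w \<le> t / 2 * c + A_op_seminorm A (\<lambda>x. a t *\<^sub>R U x + b t *\<^sub>R V x)"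
  shows "w \<le> (LEAST m. \<exists>t\<in>{0..1}.
    m = t / 2 * c + A_op_seminorm A (\<lambda>x. a t *\<^sub>R U x + b t *\<^sub>R V x))"
proof -
  define g where "g t = A_op_seminorm A (\<lambda>x. a t *\<^sub>R U x + b t *\<^sub>R V x)" for t
  have g_le: "g s \<le> g t + (\<bar>a s - a t\<bar> * K + \<bar>b s - b t\<bar> * L)" for s t
    unfolding g_def by (rule A_op_seminorm_combination_Lipschitz[OF pos U V KL])
  have Lip: "\<bar>g s - g t\<bar> \<le> \<bar>a s - a t\<bar> * K + \<bar>b s - b t\<bar> * L" for s t
    using g_le[of s t] g_le[of t s] by (simp add: abs_le_iff abs_minus_commute)
  have "(g \<longlongrightarrow> g t) (at t within {0..1})" if t: "t \<in> {0..1}" for t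
  proof (rule LIM_zero_cancel, rule Lim_null_comparison)
    show "((\<lambda>s. \<bar>a s - a t\<bar> * K + \<bar>b s - b t\<bar> * L) \<longlongrightarrow> 0) (at t within {0..1})"
    proof (rule tendsto_eq_rhs)
      show "((\<lambda>s. \<bar>a s - a t\<bar> * K + \<bar>b s - b t\<bar> * L) \<longlongrightarrow>
          \<bar>a t - a t\<bar> * K + \<bar>b t - b t\<bar> * L) (at t within {0..1})"
        using cont t by (intro tendsto_intros) (auto simp: continuous_on)
    qed simp
    show "\<forall>\<^sub>F s in at t within {0..1}. norm (g s - g t) \<le> \<bar>a s - a t\<bar> * K + \<bar>b s - b t\<bar> * L"
      using Lip by simp
  qed
  then have "continuous_on {0..1} g"
    by (simp add: continuous_on)
  then have "continuous_on {0..1} (\<lambda>t. t / 2 * c + g t)"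
    by (intro continuous_intros) auto
  then have "w \<le> (LEAST m. \<exists>t\<in>{0..1}. m = t / 2 * c + g t)"
    by (rule le_LEAST_image_continuous) (unfold g_def, rule le)
  then show ?thesis
    unfolding g_def .
qed


section \<open>The inequality\<close>

text \<open>The number \<open>q\<close> stands for either Cauchy-Schwarz bound:
  \<open>A_norm A (T x)\<close> leads to \<open>beta1\<close> and \<open>A_norm A (R x)\<close> to
  \<open>beta2\<close>.\<close>

lemma A_inner_le_Buzano_mix:
  assumes pos: "positive_operator A" and adj: "is_A_adjoint A T R"
    and x: "A_norm A x = 1" and t: "t \<in> {0..1}"
    and q: "cmod (A_inner A (T x) x) \<le> q"
  shows "(cmod (A_inner A (T x) x))\<^sup>2 \<le> t / 2 * cmod (A_inner A (T (T x)) x) +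
    t / 4 * ((A_norm A (T x))\<^sup>2 + (A_norm A (R x))\<^sup>2) + (1 - t) * q\<^sup>2"
proof -
  \<comment> \<open>These identities turn the left side of Buzano's inequality into a square and its
    mixed term into the form of \<open>T \<circ> T\<close>.\<close>
  have "A_inner A (T x) (R x) = A_inner A (T (T x)) x" "A_inner A x (R x) = A_inner A (T x) x"
    using adj by (simp_all add: is_A_adjoint_def)
  then have "(cmod (A_inner A (T x) x))\<^sup>2 \<le>
      (A_norm A (T x) * A_norm A (R x) + cmod (A_inner A (T (T x)) x)) / 2"
    using A_inner_Buzano[OF pos x, of "T x" "R x"] by (simp add: norm_mult power2_eq_square)
  also have "A_norm A (T x) * A_norm A (R x) \<le> ((A_norm A (T x))\<^sup>2 + (A_norm A (R x))\<^sup>2) / 2"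
    using sum_squares_bound[of "A_norm A (T x)" "A_norm A (R x)"] by simp
  finally have 1: "(cmod (A_inner A (T x) x))\<^sup>2 \<le> cmod (A_inner A (T (T x)) x) / 2 +
      ((A_norm A (T x))\<^sup>2 + (A_norm A (R x))\<^sup>2) / 4"
    by (simp add: field_simps)
  have 2: "(cmod (A_inner A (T x) x))\<^sup>2 \<le> q\<^sup>2"
    using q by (intro power_mono) auto
  have "(cmod (A_inner A (T x) x))\<^sup>2 =
      t * (cmod (A_inner A (T x) x))\<^sup>2 + (1 - t) * (cmod (A_inner A (T x) x))\<^sup>2"
    by (simp add: algebra_simps)
  also have "\<dots> \<le> t * (cmod (A_inner A (T (T x)) x) / 2 +
      ((A_norm A (T x))\<^sup>2 + (A_norm A (R x))\<^sup>2) / 4) + (1 - t) * q\<^sup>2"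
    using 1 2 t by (intro add_mono mult_left_mono) auto
  finally show ?thesis
    by (simp add: algebra_simps add_divide_distrib)
qed

text \<open>Moving one factor across the form turns \<open>T (R x)\<close> and
  \<open>R (T x)\<close> into squared seminorms. The value is real, hence at most its
  modulus.\<close>

lemma A_inner_combination_self:
  assumes pos: "positive_operator A" and adj: "is_A_adjoint A T R"
  shows "A_inner A (a *\<^sub>R T (R x) + b *\<^sub>R R (T x)) x =
    of_real (a * (A_norm A (R x))\<^sup>2 + b * (A_norm A (T x))\<^sup>2)"
proof -
  have "A_inner A (T (R x)) x = of_real ((A_norm A (R x))\<^sup>2)"
    using adj by (simp add: is_A_adjoint_def A_inner_self[OF pos])
  moreover have "A_inner A (R (T x)) x = of_real ((A_norm A (T x))\<^sup>2)"
    by (simp add: is_A_adjoint_swap[OF pos adj] A_inner_self[OF pos])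
  ultimately show ?thesis
    by (simp add: A_inner_linear[OF pos])
qed

text \<open>The bounds \<open>N\<close> and \<open>K\<close> make the suprema on the right finite;
  \<open>ab\<close> lists the coefficient pairs of \<open>beta1\<close> and
  \<open>beta2\<close>.\<close>

lemma numerical_radius_power2_le:
  assumes pos: "positive_operator A" and adj: "is_A_adjoint A T R"
    and numT: "\<And>x. A_norm A x = 1 \<Longrightarrow> cmod (A_inner A ((T \<circ> T) x) x) \<le> N"
    and bd: "\<And>x. A_norm A x = 1 \<Longrightarrow> A_norm A (a *\<^sub>R T (R x) + b *\<^sub>R R (T x)) \<le> K"
    and t: "t \<in> {0..1}"
    and ab: "a = t / 4 \<and> b = 1 - 3 * t / 4 \<or> a = 1 - 3 * t / 4 \<and> b = t / 4"
  shows "(A_numerical_radius A T)\<^sup>2 \<le> t / 2 * A_numerical_radius A (T \<circ> T) +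
    A_op_seminorm A (\<lambda>x. a *\<^sub>R T (R x) + b *\<^sub>R R (T x))"
    (is "_ \<le> ?B")
proof -
  define P where "P x = a *\<^sub>R T (R x) + b *\<^sub>R R (T x)" for x
  have "0 \<le> A_numerical_radius A (T \<circ> T)"
    by (rule A_numerical_radius_nonneg) (rule numT)
  moreover have "0 \<le> A_op_seminorm A P"
    by (rule A_op_seminorm_nonneg) (unfold P_def, rule bd)
  ultimately have B: "?B \<ge> 0"
    using t by (simp flip: P_def)
  have main: "(cmod (A_inner A (T x) x))\<^sup>2 \<le> ?B" if x: "A_norm A x = 1" for x
  proof -
    have "cmod (A_inner A (T x) x) \<le> A_norm A (T x)"
      using A_inner_Cauchy_Schwarz[OF pos, of "T x" x] x by simp
    moreover have "cmod (A_inner A (T x) x) \<le> A_norm A (R x)"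
      using A_inner_Cauchy_Schwarz[OF pos, of x "R x"] x adj by (simp add: is_A_adjoint_def)
    ultimately have mix:
      "(cmod (A_inner A (T x) x))\<^sup>2 \<le> t / 2 * cmod (A_inner A (T (T x)) x) +
        t / 4 * ((A_norm A (T x))\<^sup>2 + (A_norm A (R x))\<^sup>2) + (1 - t) * q\<^sup>2"
      if "q = A_norm A (T x) \<or> q = A_norm A (R x)" for q
      using that by (intro A_inner_le_Buzano_mix[OF pos adj x t]) auto
    \<comment> \<open>The coefficient \<open>1 - 3 * t / 4\<close> is
      \<open>t / 4 + (1 - t)\<close>: the Cauchy-Schwarz share falls on the vector chosen for
      \<open>q\<close>.\<close>
    from ab have "(cmod (A_inner A (T x) x))\<^sup>2 \<le> t / 2 * cmod (A_inner A (T (T x)) x) +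
        (a * (A_norm A (R x))\<^sup>2 + b * (A_norm A (T x))\<^sup>2)"
    proof
      assume "a = t / 4 \<and> b = 1 - 3 * t / 4"
      then have "a = t / 4" "b = 1 - 3 * t / 4" by auto
      then show ?thesis
        using mix[of "A_norm A (T x)"] by (simp only:) (simp add: field_simps)
    next
      assume "a = 1 - 3 * t / 4 \<and> b = t / 4"
      then have "a = 1 - 3 * t / 4" "b = t / 4" by auto
      then show ?thesis
        using mix[of "A_norm A (R x)"] by (simp only:) (simp add: field_simps)
    qed
    also have "a * (A_norm A (R x))\<^sup>2 + b * (A_norm A (T x))\<^sup>2 \<le> cmod (A_inner A (P x) x)"
      unfolding P_def A_inner_combination_self[OF pos adj] norm_of_real by simp
    also have "\<dots> \<le> A_norm A (P x)"
      using A_inner_Cauchy_Schwarz[OF pos, of "P x" x] x by simp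
    also have "\<dots> \<le> A_op_seminorm A P"
      by (rule A_norm_le_seminorm[OF _ x]) (unfold P_def, rule bd)
    also have "t / 2 * cmod (A_inner A (T (T x)) x) \<le> t / 2 * A_numerical_radius A (T \<circ> T)"
    proof (rule mult_left_mono)
      show "cmod (A_inner A (T (T x)) x) \<le> A_numerical_radius A (T \<circ> T)"
        using cmod_A_inner_le_numerical_radius[of A "T \<circ> T" N x] numT x by simp
    qed (use t in simp)
    finally show ?thesis
      by (simp add: P_def[abs_def])
  qed
  \<comment> \<open>The supremum runs over unsquared values, so the bound is passed through the
    square root and squared again at the end.\<close>
  have "cmod (A_inner A (T x) x) \<le> sqrt ?B" if "A_norm A x = 1" for x
    using main[OF that] by (rule real_le_rsqrt)
  then have "A_numerical_radius A T \<le> sqrt ?B" and "0 \<le> A_numerical_radius A T"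
    using B by (auto intro: A_numerical_radius_leI A_numerical_radius_nonneg)
  then have "(A_numerical_radius A T)\<^sup>2 \<le> (sqrt ?B)\<^sup>2"
    by (intro power_mono)
  then show ?thesis
    using B by simp
qed

theorem corollary2p7:
  fixes A T :: "'a::complex_hilbert_space \<Rightarrow> 'a"
  assumes "positive_operator A"
    and "T \<in> A_adjointable A"
  shows "(A_numerical_radius A T)\<^sup>2 \<le> min (beta1 A T) (beta2 A T)"
proof -
  define R where "R = sharp A T"
  note pos = assms(1)
  have adj: "is_A_adjoint A T R"
    unfolding R_def by (rule sharp_is_A_adjoint[OF assms])
  have T: "T \<in> bounded_operators" and R: "R \<in> bounded_operators"
    using assms(2) adj by (auto simp: A_adjointable_def is_A_adjoint_def)
  \<comment> \<open>Since \<open>T\<close> is in turn an \<open>A\<close>-adjoint of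
    \<open>R\<close>, the seminorm bound applies to \<open>R\<close> too.\<close>
  have adj': "is_A_adjoint A R T"
    using T is_A_adjoint_swap[OF pos adj] by (simp add: is_A_adjoint_def)
  obtain K where K: "K \<ge> 0" "\<And>x. A_norm A (T x) \<le> K * A_norm A x"
    using A_adjoint_bounded[OF pos T adj] by metis
  obtain L where L: "L \<ge> 0" "\<And>x. A_norm A (R x) \<le> L * A_norm A x"
    using A_adjoint_bounded[OF pos R adj'] by metis
  have TT: "A_norm A (T (T x)) \<le> K * K" if "A_norm A x = 1" for x
    using K(2)[of "T x"] mult_left_mono[OF K(2)[of x] K(1)] that by simp
  have TR: "A_norm A (T (R x)) \<le> K * L" if "A_norm A x = 1" for x
    using K(2)[of "R x"] mult_left_mono[OF L(2)[of x] K(1)] that by simp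
  have RT: "A_norm A (R (T x)) \<le> L * K" if "A_norm A x = 1" for x
    using L(2)[of "T x"] mult_left_mono[OF K(2)[of x] L(1)] that by simp
  have num: "cmod (A_inner A ((T \<circ> T) x) x) \<le> K * K" if "A_norm A x = 1" for x
    using A_inner_Cauchy_Schwarz[OF pos, of "T (T x)" x] TT[OF that] that by simp
  have bd: "A_norm A (a *\<^sub>R T (R x) + b *\<^sub>R R (T x)) \<le> \<bar>a\<bar> * (K * L) + \<bar>b\<bar> * (L * K)"
    if "A_norm A x = 1" for a b x
    by (rule A_op_seminorm_combination_bound[OF pos TR RT that])
  \<comment> \<open>Both minima are handled at once: they differ only in which product carries the
    coefficient \<open>t / 4\<close>.\<close>
  have le_LEAST: "(A_numerical_radius A T)\<^sup>2 \<le> (LEAST m. \<exists>t\<in>{0..1}.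
      m = t / 2 * A_numerical_radius A (T \<circ> T) +
        A_op_seminorm A (\<lambda>x. a t *\<^sub>R T (R x) + b t *\<^sub>R R (T x)))"
    if cont: "continuous_on {0..1} a" "continuous_on {0..1} b"
      and ab: "\<And>t. a t = t / 4 \<and> b t = 1 - 3 * t / 4 \<or> a t = 1 - 3 * t / 4 \<and> b t = t / 4"
    for a b :: "real \<Rightarrow> real"
  proof (rule le_LEAST_seminorm_combination[where U = "\<lambda>x. T (R x)" and V = "\<lambda>x. R (T x)"
        and K = "K * L" and L = "L * K", OF pos TR RT _ _ cont])
    show "0 \<le> K * L" "0 \<le> L * K"
      using K(1) L(1) by simp_all
    show "(A_numerical_radius A T)\<^sup>2 \<le> t / 2 * A_numerical_radius A (T \<circ> T) +
        A_op_seminorm A (\<lambda>x. a t *\<^sub>R T (R x) + b t *\<^sub>R R (T x))" if "t \<in> {0..1}" for t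
      by (rule numerical_radius_power2_le[OF pos adj num bd that ab])
  qed
  have "(A_numerical_radius A T)\<^sup>2 \<le> beta1 A T"
    unfolding beta1_def R_def[symmetric] by (rule le_LEAST) (auto intro!: continuous_intros)
  moreover have "(A_numerical_radius A T)\<^sup>2 \<le> beta2 A T"
    unfolding beta2_def R_def[symmetric] by (rule le_LEAST) (auto intro!: continuous_intros)
  ultimately show ?thesis
    by simp
qed

end
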